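(* Let $A \in \mathbb{C}^{n \times n}$ and $k= \mathrm{ind}(A)$. Then $X \in \mathbb{C}^{n \times n}$ satisfies the system $$XAX=X, \quad AX=P_{\mathcal{R}(A)}, \quad \mathcal{R}(X) \supseteq \mathcal{R}(A^k)$$ if and only if $X \in A\{1,2,3,1^{k}\}$.
   Context: $\mathcal{R}(\cdot)$ denotes range; $*$ is conjugate transpose; $P_{\mathcal{S}}$ is the orthogonal projector onto the subspace $\mathcal{S}$. $\mathrm{ind}(A)$ is the smallest non-negative integer $j$ with $\mathrm{rank}(A^j)=\mathrm{rank}(A^{j+1})$ (with $A^0=I$). $A\{1,2,3,1^k\}$ is the set of all $X\in\mathbb{C}^{n\times n}$ with $AXA=A$, $XAX=X$, $(AX)^*=AX$ and $XA^{k+1}=A^k$. *)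

theory Defs
  imports "Jordan_Normal_Form.Schur_Decomposition" "Jordan_Normal_Form.DL_Rank"
begin

definition mat_range :: "complex mat \<Rightarrow> complex vec set" where
  "mat_range A = (\<lambda>x. A *\<^sub>v x) ` carrier_vec (dim_col A)"

(* Orthogonality is with respect to the Hermitian inner product on C^n.
   When S is a linear subspace of C^n, exactly one matrix P has this property;
   for other sets S the value is unspecified. *)
definition orth_projector :: "nat \<Rightarrow> complex vec set \<Rightarrow> complex mat" where
  "orth_projector n S = (THE P. P \<in> carrier_mat n n \<and>
     (\<forall>v \<in> carrier_vec n. P *\<^sub>v v \<in> S \<and> (\<forall>u \<in> S. (v - P *\<^sub>v v) \<bullet>c u = 0)))"

definition mat_index :: "complex mat \<Rightarrow> nat" where
  "mat_index A = (LEAST j. vec_space.rank (dim_row A) (A ^\<^sub>m j)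
                         = vec_space.rank (dim_row A) (A ^\<^sub>m (j + 1)))"

(* The set A{1,2,3,1^k} for a square matrix A. *)
definition inverses_1_2_3_1k :: "complex mat \<Rightarrow> nat \<Rightarrow> complex mat set" where
  "inverses_1_2_3_1k A k = {X \<in> carrier_mat (dim_row A) (dim_row A).
     A * X * A = A \<and> X * A * X = X \<and> mat_adjoint (A * X) = A * X \<and>
     X * A ^\<^sub>m (k + 1) = A ^\<^sub>m k}"

end

theory Submission
  imports Defs
begin

(* If A = A X A and A X is Hermitian, then A X is the orthogonal projector onto the range of A, so
   only the converse needs work: since orth_projector is a definite description, one has to know
   that the projector exists and is of the form A Y. It is built from the columns of A one at a
   time, as in the Gram-Schmidt process: a column u whose residual w = u - P u is nonzero
   contributes the rank-one projector w w^* / (w^* w).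
   Given X A X = X, the condition X A^(k+1) = A^k says that X A fixes the range of A^k; as X A is
   idempotent with the same range as X, this is the inclusion of ranges. *)

section \<open>Adjoint matrices and the Hermitian inner product\<close>

lemma mat_adjoint_carrier [simp, intro]:
  "A \<in> carrier_mat n m \<Longrightarrow> mat_adjoint A \<in> carrier_mat m n"
  unfolding mat_adjoint_def by auto

lemma mat_adjoint_dim [simp]:
  "dim_row (mat_adjoint A) = dim_col A" "dim_col (mat_adjoint A) = dim_row A"
  unfolding mat_adjoint_def by auto

lemma mat_adjoint_index [simp]:
  assumes "i < dim_col A" "j < dim_row A"
  shows "mat_adjoint A $$ (i, j) = conjugate (A $$ (j, i))"
  using assms unfolding mat_adjoint_def by (simp add: mat_of_rows_def)

lemma mat_adjoint_add:
  assumes "A \<in> carrier_mat n m" "B \<in> carrier_mat n m"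
  shows "mat_adjoint (A + B) = mat_adjoint A + mat_adjoint B"
  using assms by (intro eq_matI) (auto simp: conjugate_dist_add)

lemma mat_adjoint_mult:
  assumes "A \<in> carrier_mat n m" "B \<in> carrier_mat m p"
  shows "mat_adjoint (A * B) = mat_adjoint B * mat_adjoint A"
  using assms
  by (intro eq_matI) (auto simp: scalar_prod_def sum_conjugate conjugate_dist_mul mult.commute)

text \<open>Both sides expand to the same double sum, taken in the two possible orders. For a
  Hermitian \<open>P\<close> it moves \<open>P\<close> from one argument of the inner product to the
  other, which drives every orthogonality argument below.\<close>

lemma cscalar_prod_mat_adjoint:
  fixes A :: "'a :: conjugatable_field mat"
  assumes A: "A \<in> carrier_mat n m" and x: "x \<in> carrier_vec m" and y: "y \<in> carrier_vec n"
  shows "(A *\<^sub>v x) \<bullet>c y = x \<bullet>c (mat_adjoint A *\<^sub>v y)"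
proof -
  have "(A *\<^sub>v x) \<bullet>c y = (\<Sum>i<n. \<Sum>j<m. A $$ (i,j) * x $ j * conjugate (y $ i))"
    using A x y by (simp add: scalar_prod_def atLeast0LessThan sum_distrib_right)
  also have "\<dots> = (\<Sum>j<m. \<Sum>i<n. A $$ (i,j) * x $ j * conjugate (y $ i))"
    by (rule sum.swap)
  also have "\<dots> = x \<bullet>c (mat_adjoint A *\<^sub>v y)"
    using A x y
    by (simp add: scalar_prod_def atLeast0LessThan sum_distrib_left sum_conjugate
        conjugate_dist_mul mult_ac)
  finally show ?thesis .
qed

lemma cscalar_prod_minus_left:
  fixes x y z :: "'a :: conjugatable_ring vec"
  assumes "x \<in> carrier_vec n" "y \<in> carrier_vec n" "z \<in> carrier_vec n"
  shows "(x - y) \<bullet>c z = x \<bullet>c z - y \<bullet>c z"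
  using assms by (auto simp: scalar_prod_def left_diff_distrib sum_subtractf)

lemma cscalar_prod_minus_right:
  fixes x y z :: "'a :: conjugatable_ring vec"
  assumes "x \<in> carrier_vec n" "y \<in> carrier_vec n" "z \<in> carrier_vec n"
  shows "x \<bullet>c (y - z) = x \<bullet>c y - x \<bullet>c z"
proof -
  have "conjugate (a - b) = conjugate a - conjugate b" for a b :: 'a
    using conjugate_dist_add[of a "- b"] by (simp add: conjugate_neg)
  then show ?thesis
    using assms by (auto simp: scalar_prod_def right_diff_distrib sum_subtractf)
qed

section \<open>Outer products and elementary matrix facts\<close>

text \<open>This is \<open>x y^*\<close>. Conjugating the second factor makes it act through the
  Hermitian product, so that a scaled \<open>outer_prod w w\<close> projects orthogonally onto the
  line of a nonzero \<open>w\<close>.\<close>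

definition outer_prod :: "'a :: conjugatable_field vec \<Rightarrow> 'a vec \<Rightarrow> 'a mat" where
  "outer_prod x y = mat (dim_vec x) (dim_vec y) (\<lambda>(i, j). x $ i * conjugate (y $ j))"

lemma outer_prod_carrier [simp, intro]:
  "x \<in> carrier_vec n \<Longrightarrow> y \<in> carrier_vec m \<Longrightarrow> outer_prod x y \<in> carrier_mat n m"
  unfolding outer_prod_def by auto

lemma outer_prod_mult_vec:
  assumes "x \<in> carrier_vec n" "y \<in> carrier_vec m" "z \<in> carrier_vec m"
  shows "outer_prod x y *\<^sub>v z = (z \<bullet>c y) \<cdot>\<^sub>v x"
  using assms
  by (intro eq_vecI) (auto simp: outer_prod_def scalar_prod_def sum_distrib_left sum_distrib_right mult_ac)

lemma mult_outer_prod: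
  assumes "A \<in> carrier_mat p n" "x \<in> carrier_vec n" "y \<in> carrier_vec m"
  shows "A * outer_prod x y = outer_prod (A *\<^sub>v x) y"
  using assms
  by (intro eq_matI) (auto simp: outer_prod_def scalar_prod_def sum_distrib_left mult_ac)

lemma mat_adjoint_outer_prod:
  "mat_adjoint (outer_prod x y) = outer_prod y x"
  by (intro eq_matI) (auto simp: outer_prod_def conjugate_dist_mul)

lemma mult_mat_vec_unit:
  fixes A :: "'a :: semiring_1 mat"
  assumes "A \<in> carrier_mat n m" "i < m"
  shows "A *\<^sub>v unit_vec m i = col A i"
  using assms by (intro eq_vecI) auto

lemma minus_vec_eq_0_iff:
  fixes x y :: "'a :: group_add vec"
  assumes "x \<in> carrier_vec n" "y \<in> carrier_vec n"
  shows "x - y = 0\<^sub>v n \<longleftrightarrow> x = y"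
  using assms by (auto simp: vec_eq_iff)

text \<open>The recursion of \<open>^\<^sub>m\<close> appends the new factor on the right, whereas
  cancelling against \<open>X * A\<close> requires a factor \<open>A\<close> on the left.\<close>

lemma pow_mat_commute:
  assumes A: "A \<in> carrier_mat n n"
  shows "A ^\<^sub>m k * A = A * A ^\<^sub>m k"
proof (induction k)
  case (Suc k)
  have "A ^\<^sub>m k \<in> carrier_mat n n" using A by simp
  then show ?case using A Suc assoc_mult_mat[of A n n "A ^\<^sub>m k" n A n] by simp
qed (use A in simp)

section \<open>Existence of the orthogonal projector onto a range\<close>

text \<open>Induction on the number of columns treated. The factorization \<open>P = A * Y\<close>
  keeps the range of \<open>P\<close> inside that of \<open>A\<close> and yields the generalized
  inverse \<open>Y\<close> along the way.\<close>

lemma orth_projection_onto_columns: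
  fixes A :: "'a :: conjugatable_ordered_field mat"
  assumes A: "A \<in> carrier_mat n m" and "j \<le> m"
  shows "\<exists>P Y. P \<in> carrier_mat n n \<and> Y \<in> carrier_mat m n \<and> P = A * Y \<and> P * P = P \<and>
    mat_adjoint P = P \<and> (\<forall>i<j. P *\<^sub>v col A i = col A i)"
  using \<open>j \<le> m\<close>
proof (induction j)
  case 0
  show ?case
    using A by (intro exI[of _ "0\<^sub>m n n"] exI[of _ "0\<^sub>m m n"]) (auto intro!: eq_matI)
next
  case (Suc j)
  then obtain P Y where P: "P \<in> carrier_mat n n" and Y: "Y \<in> carrier_mat m n"
    and PAY: "P = A * Y" and PP: "P * P = P" and PH: "mat_adjoint P = P"
    and Pcol: "\<And>i. i < j \<Longrightarrow> P *\<^sub>v col A i = col A i"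
    by auto
  define u where "u = col A j"
  define w where "w = u - P *\<^sub>v u"
  have u: "u \<in> carrier_vec n" and w: "w \<in> carrier_vec n"
    using A P by (auto simp: u_def w_def)
  show ?case
  proof (cases "w = 0\<^sub>v n")
    case True
    \<comment> \<open>A zero residual means that \<open>P\<close> already fixes the new column, so
      \<open>P\<close> and \<open>Y\<close> are kept.\<close>
    have "P *\<^sub>v u = u"
      using True u P by (simp add: w_def minus_vec_eq_0_iff[of _ n])
    then show ?thesis
      using P Y PAY PP PH Pcol by (auto simp: less_Suc_eq u_def)
  next
    case False
    define c where "c = w \<bullet>c w"
    \<comment> \<open>A preimage of the residual: \<open>A\<close> sends \<open>unit_vec m j\<close>
      to \<open>u\<close> and \<open>Y *\<^sub>v u\<close> to \<open>P *\<^sub>v u\<close>. It lets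
      the correction to \<open>P\<close> be factored through \<open>A\<close> as well.\<close>
    define z where "z = unit_vec m j - Y *\<^sub>v u"
    define z' where "z' = (1 / c) \<cdot>\<^sub>v z"
    define w' where "w' = (1 / c) \<cdot>\<^sub>v w"
    have c: "c \<noteq> 0"
      using conjugate_square_eq_0_vec[OF w] False by (simp add: c_def)
    have z: "z \<in> carrier_vec m" and z': "z' \<in> carrier_vec m" and w': "w' \<in> carrier_vec n"
      using Y u w by (auto simp: z_def z'_def w'_def)
    have "A *\<^sub>v unit_vec m j = u"
      using A Suc.prems by (simp add: u_def mult_mat_vec_unit)
    then have Az: "A *\<^sub>v z = w"
      using A Y u Suc.prems
      by (simp add: z_def w_def PAY mult_minus_distrib_mat_vec[of A n m])
    then have Az': "A *\<^sub>v z' = w'"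
      using A z by (simp add: z'_def w'_def mult_mat_vec)
    define R where "R = outer_prod w' w"
    have R: "R \<in> carrier_mat n n" using w w' by (simp add: R_def)
    have RH: "mat_adjoint R = R"
    proof -
      \<comment> \<open>The scalar \<open>c\<close> is an inner product of a vector with itself, so
        it is self-conjugate and conjugation passes through division by it; hence scaling by
        \<open>1 / c\<close> keeps \<open>R\<close> Hermitian.\<close>
      have "conjugate c = c"
        using conjugate_vec_sprod_comm[OF w w] conjugate_conjugate_sprod[OF w w]
        by (simp add: c_def)
      moreover have "conjugate (1 / c) * conjugate c = 1"
        using c conjugate_dist_mul[of "1 / c" c] conjugate_dist_mul[of 1 c]
        by (metis conjugate_zero_iff mult_cancel_right1 nonzero_eq_divide_eq)
      ultimately have "conjugate (1 / c) = 1 / c"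
        using c by (simp add: field_simps)
      then have "conjugate (x / c) = conjugate x / c" for x
        using conjugate_dist_mul[of x "1 / c"] by simp
      then show ?thesis
        unfolding R_def mat_adjoint_outer_prod
        by (intro eq_matI) (auto simp: outer_prod_def w'_def conjugate_dist_mul)
    qed
    have Rw: "R *\<^sub>v x = (x \<bullet>c w / c) \<cdot>\<^sub>v w" if "x \<in> carrier_vec n" for x
      using that w w' by (simp add: R_def outer_prod_mult_vec[of _ n _ n] w'_def smult_smult_assoc)
    \<comment> \<open>Idempotence gives \<open>P u - P (P u) = 0\<close>. This makes
      \<open>P * R\<close> vanish, and taking adjoints makes \<open>R * P\<close> vanish
      too.\<close>
    have Pw: "P *\<^sub>v w = 0\<^sub>v n"
      using P u PP
      by (simp add: w_def mult_minus_distrib_mat_vec[of P n n] assoc_mult_mat_vec[symmetric, of P n n])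
    have "P *\<^sub>v w' = 0\<^sub>v n"
      using Pw P w by (auto simp: w'_def mult_mat_vec intro!: eq_vecI)
    moreover have "P * R = outer_prod (P *\<^sub>v w') w"
      unfolding R_def by (rule mult_outer_prod[OF P w' w])
    ultimately have PR: "P * R = 0\<^sub>m n n"
      using w by (auto simp: outer_prod_def intro!: eq_matI)
    have RP: "R * P = 0\<^sub>m n n"
    proof -
      have "R * P = mat_adjoint (P * R)"
        using mat_adjoint_mult[OF P R] by (simp add: PH RH)
      then show ?thesis unfolding PR by (auto intro!: eq_matI)
    qed
    have RR: "R * R = R"
    proof -
      have "R *\<^sub>v w' = w'"
        using c w Rw[OF w] R by (simp add: w'_def mult_mat_vec c_def[symmetric])
      then show ?thesis
        using mult_outer_prod[OF R w' w] by (simp add: R_def)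
    qed
    \<comment> \<open>Earlier columns are fixed by the Hermitian \<open>P\<close>, hence orthogonal
      to the residual; \<open>R\<close> therefore kills them and \<open>P + R\<close> still fixes
      them.\<close>
    have cross: "col A i \<bullet>c w = 0" if "i < j" for i
    proof -
      have a: "col A i \<in> carrier_vec n" using A by auto
      have "col A i \<bullet>c (P *\<^sub>v u) = col A i \<bullet>c u"
        using cscalar_prod_mat_adjoint[OF P a u] Pcol[OF that] by (simp add: PH)
      then show ?thesis
        using cscalar_prod_minus_right[OF a u, of "P *\<^sub>v u"] P u by (simp add: w_def)
    qed
    \<comment> \<open>Since \<open>u = P u + w\<close> with \<open>P u\<close> orthogonal to
      \<open>w\<close>, only \<open>w \<bullet>c w\<close> survives. Thus \<open>R\<close> maps
      \<open>u\<close> to \<open>w\<close>, exactly the part that \<open>P\<close> misses.\<close>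
    have wu: "u \<bullet>c w = c"
    proof -
      have "(P *\<^sub>v u) \<bullet>c w = 0"
        using cscalar_prod_mat_adjoint[OF P u w] u by (simp add: PH Pw)
      then show ?thesis
        using cscalar_prod_minus_left[OF u _ w, of "P *\<^sub>v u"] P u w by (simp add: c_def w_def)
    qed
    define Y' where "Y' = Y + outer_prod z' w"
    have fix_cols: "(P + R) *\<^sub>v col A i = col A i" if "i < Suc j" for i
    proof (cases "i < j")
      case True
      have a: "col A i \<in> carrier_vec n" using A by auto
      then show ?thesis
        using A P R w Pcol[OF True] Rw[OF a] cross[OF True]
        by (intro eq_vecI) (auto simp: add_mult_distrib_mat_vec[of P n n])
    next
      case False
      then have i: "col A i = u" using that by (simp add: u_def less_Suc_eq)
      have "(P + R) *\<^sub>v u = P *\<^sub>v u + w"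
        using P R u w Rw[OF u] wu c by (simp add: add_mult_distrib_mat_vec[of P n n])
      also have "\<dots> = u" using P u by (auto simp: w_def)
      finally show ?thesis by (simp add: i)
    qed
    have "P + R = A * Y'"
      using A Y z' w
      by (simp add: Y'_def PAY R_def mult_add_distrib_mat[of A n m] mult_outer_prod[of A n m] Az')
    moreover have "(P + R) * (P + R) = P + R"
      using P R
      by (simp add: mult_add_distrib_mat[of _ n n] add_mult_distrib_mat[of _ n n] PP PR RP RR)
    moreover have "mat_adjoint (P + R) = P + R"
      using P R by (simp add: mat_adjoint_add[of P n n] PH RH)
    moreover have "P + R \<in> carrier_mat n n" "Y' \<in> carrier_mat m n"
      using P R Y z' w by (auto simp: Y'_def)
    ultimately show ?thesis using fix_cols by blast
  qed
qed

text \<open>Once all \<open>m\<close> columns are treated, \<open>P = A * Y\<close> fixes each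
  column of \<open>A\<close>, which is the equation \<open>A * Y * A = A\<close>.\<close>

lemma ex_orth_projector:
  fixes A :: "'a :: conjugatable_ordered_field mat"
  assumes A: "A \<in> carrier_mat n m"
  obtains Y where "Y \<in> carrier_mat m n" "A * Y * A = A" "mat_adjoint (A * Y) = A * Y"
proof -
  obtain P Y where P: "P \<in> carrier_mat n n" and Y: "Y \<in> carrier_mat m n" and "P = A * Y"
    and H: "mat_adjoint P = P" and fix_cols: "\<forall>i<m. P *\<^sub>v col A i = col A i"
    using orth_projection_onto_columns[OF A order.refl] by blast
  have "P * A = A"
  proof (rule mat_col_eqI)
    fix i assume "i < dim_col A"
    then show "col (P * A) i = col A i"
      using A P fix_cols col_mult2[OF P A] by simp
  qed (use A P in auto)
  then show ?thesis using that Y H \<open>P = A * Y\<close> by blast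
qed

section \<open>Ranges and uniqueness of the projector\<close>

lemma mult_vec_in_mat_range:
  "A \<in> carrier_mat n m \<Longrightarrow> x \<in> carrier_vec m \<Longrightarrow> A *\<^sub>v x \<in> mat_range A"
  unfolding mat_range_def by auto

lemma mat_rangeE:
  assumes "y \<in> mat_range A" "A \<in> carrier_mat n m"
  obtains x where "x \<in> carrier_vec m" "y = A *\<^sub>v x"
  using assms unfolding mat_range_def by auto

text \<open>The matrix \<open>A * Y\<close> fixes the range of \<open>A\<close>, and being Hermitian
  it leaves residuals orthogonal to that range. Uniqueness must be shown as well to evaluate the
  definite description.\<close>

lemma orth_projector_mat_range:
  assumes A: "A \<in> carrier_mat n m" and Y: "Y \<in> carrier_mat m n"
    and AYA: "A * Y * A = A" and H: "mat_adjoint (A * Y) = A * Y"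
  shows "orth_projector n (mat_range A) = A * Y"
  unfolding orth_projector_def
proof (rule the_equality)
  define P where "P = A * Y"
  have P: "P \<in> carrier_mat n n" using A Y by (simp add: P_def)
  have PA: "P *\<^sub>v (A *\<^sub>v x) = A *\<^sub>v x" if "x \<in> carrier_vec m" for x
    using AYA A P that by (metis P_def assoc_mult_mat_vec)
  have range: "P *\<^sub>v v \<in> mat_range A" if "v \<in> carrier_vec n" for v
    using mult_vec_in_mat_range[OF A, of "Y *\<^sub>v v"] A Y that
    by (simp add: P_def assoc_mult_mat_vec[of A n m Y n])
  have orth: "(v - P *\<^sub>v v) \<bullet>c u = 0" if v: "v \<in> carrier_vec n" and u: "u \<in> mat_range A" for v u
  proof -
    obtain x where x: "x \<in> carrier_vec m" and ux: "u = A *\<^sub>v x"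
      using u A by (rule mat_rangeE)
    have uc: "u \<in> carrier_vec n" using A x ux by simp
    have "(P *\<^sub>v v) \<bullet>c u = v \<bullet>c u"
      using cscalar_prod_mat_adjoint[OF P v uc] H PA[OF x] by (simp add: P_def ux)
    then show ?thesis
      using cscalar_prod_minus_left[OF v _ uc, of "P *\<^sub>v v"] P v by simp
  qed
  show "A * Y \<in> carrier_mat n n \<and> (\<forall>v\<in>carrier_vec n. A * Y *\<^sub>v v \<in> mat_range A \<and>
      (\<forall>u\<in>mat_range A. (v - A * Y *\<^sub>v v) \<bullet>c u = 0))"
    using P range orth by (simp add: P_def)
  fix Q
  assume "Q \<in> carrier_mat n n \<and> (\<forall>v\<in>carrier_vec n. Q *\<^sub>v v \<in> mat_range A \<and>
      (\<forall>u\<in>mat_range A. (v - Q *\<^sub>v v) \<bullet>c u = 0))"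
  then have Q: "Q \<in> carrier_mat n n"
    and Qrange: "\<And>v. v \<in> carrier_vec n \<Longrightarrow> Q *\<^sub>v v \<in> mat_range A"
    and Qorth: "\<And>v u. v \<in> carrier_vec n \<Longrightarrow> u \<in> mat_range A \<Longrightarrow> (v - Q *\<^sub>v v) \<bullet>c u = 0"
    by auto
  have "Q *\<^sub>v v = P *\<^sub>v v" if v: "v \<in> carrier_vec n" for v
  proof -
    \<comment> \<open>This vector lies in the range of \<open>A\<close> and is also a difference of
      two residuals orthogonal to that range, so it is orthogonal to itself and vanishes.\<close>
    define d where "d = P *\<^sub>v v - Q *\<^sub>v v"
    have p: "P *\<^sub>v v \<in> carrier_vec n" and q: "Q *\<^sub>v v \<in> carrier_vec n"
      using P Q v by auto
    then have d: "d \<in> carrier_vec n" by (simp add: d_def)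
    obtain x y where "x \<in> carrier_vec m" "P *\<^sub>v v = A *\<^sub>v x" "y \<in> carrier_vec m" "Q *\<^sub>v v = A *\<^sub>v y"
      using range[OF v] Qrange[OF v] A by (meson mat_rangeE)
    then have "d = A *\<^sub>v (x - y)" "x - y \<in> carrier_vec m"
      using A by (simp_all add: d_def mult_minus_distrib_mat_vec[of A n m])
    then have dr: "d \<in> mat_range A"
      using mult_vec_in_mat_range[OF A] by simp
    have "d \<bullet>c d = (P *\<^sub>v v) \<bullet>c d - (Q *\<^sub>v v) \<bullet>c d"
      using cscalar_prod_minus_left[OF p q d] by (simp add: d_def)
    also have "\<dots> = 0"
      using orth[OF v dr] Qorth[OF v dr] cscalar_prod_minus_left[OF v p d]
        cscalar_prod_minus_left[OF v q d] by simp
    finally have "d = 0\<^sub>v n" using conjugate_square_eq_0_vec[OF d] by simp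
    then show ?thesis
      using minus_vec_eq_0_iff[OF p q] by (simp add: d_def)
  qed
  then have "Q = P"
    using P Q by (intro mat_col_eqI) (auto simp: mult_mat_vec_unit[of _ n n, symmetric])
  then show "Q = A * Y" by (simp add: P_def)
qed

section \<open>Range inclusion as a matrix equation\<close>

lemma mat_range_mult_subset:
  assumes "A \<in> carrier_mat n m" "B \<in> carrier_mat m p"
  shows "mat_range (A * B) \<subseteq> mat_range A"
  using assms by (auto simp: mat_range_def assoc_mult_mat_vec[of A n m B p])

text \<open>From left to right, \<open>B = X * (A * B)\<close> factors through \<open>X\<close>.
  Conversely each column of \<open>B\<close> is some \<open>X *\<^sub>v x\<close>, which
  \<open>X * A\<close> fixes because \<open>X * A * X = X\<close>.\<close>

lemma mult_eq_self_iff_mat_range_subset: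
  assumes X: "X \<in> carrier_mat n m" and A: "A \<in> carrier_mat m n" and B: "B \<in> carrier_mat n p"
    and XAX: "X * A * X = X"
  shows "X * A * B = B \<longleftrightarrow> mat_range B \<subseteq> mat_range X"
proof
  assume "X * A * B = B"
  then have "X * (A * B) = B" using assms by simp
  then show "mat_range B \<subseteq> mat_range X"
    using mat_range_mult_subset[OF X, of "A * B" p] A B by simp
next
  assume sub: "mat_range B \<subseteq> mat_range X"
  show "X * A * B = B"
  proof (rule mat_col_eqI)
    fix i assume i: "i < dim_col B"
    have "col B i \<in> mat_range X"
      using sub mult_vec_in_mat_range[OF B, of "unit_vec p i"] i B
      by (auto simp: mult_mat_vec_unit)
    then obtain x where x: "x \<in> carrier_vec m" "col B i = X *\<^sub>v x"
      using X by (rule mat_rangeE)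
    have "col (X * A * B) i = X * A *\<^sub>v (X *\<^sub>v x)"
      using i x B X A by (subst col_mult2[of _ n n _ p]) auto
    also have "\<dots> = (X * A * X) *\<^sub>v x"
      using X A x by (intro assoc_mult_mat_vec[symmetric]) auto
    finally show "col (X * A * B) i = col B i" using x XAX by simp
  qed (use X A B in auto)
qed

theorem corollary4p4:
  fixes A X :: "complex mat" and n k :: nat
  assumes "A \<in> carrier_mat n n"
    and "k = mat_index A"
    and "X \<in> carrier_mat n n"
  shows "(X * A * X = X \<and> A * X = orth_projector n (mat_range A)
            \<and> mat_range X \<supseteq> mat_range (A ^\<^sub>m k))
         \<longleftrightarrow> X \<in> inverses_1_2_3_1k A k"
proof -
  note A = assms(1) and X = assms(3)
  have Ak: "A ^\<^sub>m k \<in> carrier_mat n n" using A by simp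
  have projector_iff: "A * X = orth_projector n (mat_range A) \<longleftrightarrow>
      A * X * A = A \<and> mat_adjoint (A * X) = A * X"
  proof
    assume "A * X = orth_projector n (mat_range A)"
    \<comment> \<open>The projector equals \<open>A * Y\<close> for this \<open>Y\<close>, so
      \<open>A * X = A * Y\<close> and both equations carry over to \<open>X\<close>.\<close>
    moreover obtain Y where "Y \<in> carrier_mat n n" "A * Y * A = A" "mat_adjoint (A * Y) = A * Y"
      using ex_orth_projector[OF A] .
    ultimately show "A * X * A = A \<and> mat_adjoint (A * X) = A * X"
      using orth_projector_mat_range[OF A] by metis
  qed (use orth_projector_mat_range[OF A X] in auto)
  \<comment> \<open>With the extra factor on the left, the fourth equation reads
    \<open>X * A * A ^\<^sub>m k = A ^\<^sub>m k\<close>, the form to which the range criterion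
    applies.\<close>
  have "A ^\<^sub>m (k + 1) = A * A ^\<^sub>m k"
    using pow_mat_commute[OF A] by simp
  then have "X * A ^\<^sub>m (k + 1) = X * A * A ^\<^sub>m k"
    using assoc_mult_mat[OF X A Ak] by simp
  then show ?thesis
    using projector_iff mult_eq_self_iff_mat_range_subset[OF X A Ak] A X
    by (auto simp: inverses_1_2_3_1k_def)
qed

end
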